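(* For $n\ge 6$, every $n\times n$ dissimilarity matrix has tree rank at most $n-3$.
   Context: An $n\times n$ dissimilarity matrix is a function from 2-element subsets of $[n]$ to $\mathbb{R}$. A tree matrix is a dissimilarity matrix $D$ such that for all distinct $i,j,k,l$ the minimum of $D_{ij}+D_{kl}$, $D_{ik}+D_{jl}$, $D_{il}+D_{jk}$ is attained at least twice. The tree rank of $M$ is the least $r$ such that $M$ is the entrywise minimum of $r$ tree matrices. *)

theory Defs
  imports Complex_Main "HOL-Library.FuncSet" "HOL-Library.Extended_Nat" "HOL-Library.Ramsey"
begin

text \<open>An n x n dissimilarity matrix: a real function on the 2-element subsets of [n],
  extensional, so that equality of functions is entrywise equality.\<close>

definition dissimilarity_matrices :: "nat \<Rightarrow> (nat set \<Rightarrow> real) set" where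
  "dissimilarity_matrices n = nsets {1..n} 2 \<rightarrow>\<^sub>E UNIV"

definition min_attained_twice :: "real list \<Rightarrow> bool" where
  "min_attained_twice xs \<longleftrightarrow> count_list xs (Min (set xs)) \<ge> 2"

definition tree_matrix :: "nat \<Rightarrow> (nat set \<Rightarrow> real) \<Rightarrow> bool" where
  "tree_matrix n D \<longleftrightarrow> D \<in> dissimilarity_matrices n \<and>
     (\<forall>i\<in>{1..n}. \<forall>j\<in>{1..n}. \<forall>k\<in>{1..n}. \<forall>l\<in>{1..n}. distinct [i, j, k, l] \<longrightarrow>
        min_attained_twice [D {i, j} + D {k, l}, D {i, k} + D {j, l}, D {i, l} + D {j, k}])"

text \<open>The minimum of an empty family of real matrices does not exist, hence the condition 0 < r.\<close>

definition min_of_tree_matrices :: "nat \<Rightarrow> (nat set \<Rightarrow> real) \<Rightarrow> nat \<Rightarrow> bool" where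
  "min_of_tree_matrices n M r \<longleftrightarrow> 0 < r \<and>
     (\<exists>T. (\<forall>s<r. tree_matrix n (T s)) \<and>
          M = (\<lambda>e\<in>nsets {1..n} 2. Min ((\<lambda>s. T s e) ` {..<r})))"

text \<open>The rank is valued in the extended naturals: it is infinite when M is not the minimum of
  finitely many tree matrices, so a finite upper bound on the rank includes that M is such
  a minimum.\<close>

definition tree_rank :: "nat \<Rightarrow> (nat set \<Rightarrow> real) \<Rightarrow> enat" where
  "tree_rank n M = (INF r \<in> {r. min_of_tree_matrices n M r}. enat r)"

end

theory Submission
  imports Defs
begin

text \<open>A set of pairs is covered by a tree matrix \<open>D\<close> if \<open>D\<close> dominates \<open>M\<close> and agrees with \<open>M\<close> on
  the set; the tree rank is the least number of tree matrices covering all pairs. Trees extend to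
  a new vertex by huge entries, and the pairs at the new vertex are covered by one star tree, so
  everything reduces to covering the 15 pairs on six vertices by three trees.

  Fix a vertex \<open>v\<close> and normalise \<open>M\<close> to vanish on the pairs at \<open>v\<close>. One tree covers these pairs and
  a maximal spanning tree of the remaining five vertices. If the spanning tree has a vertex of
  degree at least 3, the six uncovered pairs lie in a star and a triangle. Otherwise it is a
  Hamiltonian path, and the uncovered pairs minus a suitable star can be covered unless four
  quadruples have a prescribed strict minimum. If this fails for the endpoint \<open>a\<close>, the endpoint
  \<open>e\<close> and the omitted vertex \<open>f\<close> of a path \<open>a b c d e\<close>, then \<open>M\<close> is circular enough with respect to the
  hexagon \<open>a b c d e f\<close> for triangulations of the hexagon to give covering trees.\<close>

section \<open>Tree matrices and covers of pairs\<close>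

text \<open>Inequality form of "the minimum of three numbers is attained twice". Each inequality is
  stable under adding a constant and under entrywise minima, which is what the gluing argument
  exploits.\<close>

definition min_twice :: "real \<Rightarrow> real \<Rightarrow> real \<Rightarrow> bool" where
  "min_twice a b c \<longleftrightarrow> min b c \<le> a \<and> min a c \<le> b \<and> min a b \<le> c"

text \<open>Symmetric functions of two vertices replace functions on 2-sets, so that vertex sets can
  grow one vertex at a time; diagonal values are arbitrary.\<close>

definition tree_on :: "'a set \<Rightarrow> ('a \<Rightarrow> 'a \<Rightarrow> real) \<Rightarrow> bool" where
  "tree_on V D \<longleftrightarrow> (\<forall>i j. D i j = D j i) \<and>
     (\<forall>i\<in>V. \<forall>j\<in>V. \<forall>k\<in>V. \<forall>l\<in>V. distinct [i, j, k, l] \<longrightarrow>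
        min_twice (D i j + D k l) (D i k + D j l) (D i l + D j k))"

definition covers :: "'a set \<Rightarrow> ('a \<Rightarrow> 'a \<Rightarrow> real) \<Rightarrow> ('a \<times> 'a) set \<Rightarrow> bool" where
  "covers V M E \<longleftrightarrow> (\<exists>D. tree_on V D \<and> (\<forall>i\<in>V. \<forall>j\<in>V. i \<noteq> j \<longrightarrow> M i j \<le> D i j) \<and>
     (\<forall>(i, j)\<in>E. D i j = M i j))"

definition covered_by :: "nat \<Rightarrow> 'a set \<Rightarrow> ('a \<Rightarrow> 'a \<Rightarrow> real) \<Rightarrow> bool" where
  "covered_by k V M \<longleftrightarrow> (\<exists>E. (\<forall>s<k. covers V M (E s)) \<and>
     (\<forall>i\<in>V. \<forall>j\<in>V. i \<noteq> j \<longrightarrow> (\<exists>s<k. (i, j) \<in> E s \<or> (j, i) \<in> E s)))"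

section \<open>The four-point condition under translations and minima\<close>

lemma min_twice_ac:
  "min_twice a b c = min_twice b a c" "min_twice a b c = min_twice a c b"
  by (auto simp: min_twice_def min.commute)

lemma min_twice_add: "min_twice (a + t) (b + t) (c + t) \<longleftrightarrow> min_twice a b c"
  by (simp add: min_twice_def flip: min_add_distrib_left)

text \<open>The triples in question form a tropical hyperplane, which is tropically convex: each of
  the three inequalities passes to minima separately.\<close>

lemma min_twice_min:
  assumes "min_twice a b c" "min_twice a' b' c'"
  shows "min_twice (min a a') (min b b') (min c c')"
proof -
  have *: "min (min y y') (min z z') \<le> min x x'" if "min y z \<le> x" "min y' z' \<le> x'"
    for x y z x' y' z' :: real
    using that by (auto simp: min_le_iff_disj)
  show ?thesis using assms unfolding min_twice_def by (intro conjI *) auto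
qed

text \<open>For a new leaf x and old vertices c, d, e other than a, b: the row of x is a min-plus
  combination of the rows of a and b, so its condition is the same combination of the conditions for
  b, c, d, e and a, c, d, e. Here p, q, t stand for the entries at xa, xb, ab.\<close>

lemma min_twice_glue0:
  assumes "min_twice (b0 + u) (b1 + v) (b2 + w)" "min_twice (a0 + u) (a1 + v) (a2 + w)"
  shows "min_twice (min (p + b0) (q + a0) - t + u) (min (p + b1) (q + a1) - t + v)
    (min (p + b2) (q + a2) - t + w)"
proof -
  have eq: "min (p + x) (q + y) - t + z = min (x + z + (p - t)) (y + z + (q - t))" for x y z
    by (simp add: min_def)
  show ?thesis unfolding eq by (intro min_twice_min) (simp_all only: min_twice_add assms)
qed

text \<open>For a new leaf x and old vertices a, c, d: the last two sums share the term
  \<open>K\<close>. The triple is the minimum of a translate of the condition for a, b, c, d and the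
  trivial triple whose last two entries are \<open>K\<close> and whose first is at least
  \<open>K\<close>.\<close>

lemma min_twice_glue1:
  assumes "min_twice (t + cd) (ac + bd) (ad + bc)"
  shows "min_twice (p + cd) (min (p + bc) (q + ac) - t + ad) (min (p + bd) (q + ad) - t + ac)"
proof -
  define K where "K = q + ac + ad - t"
  have eq: "p + cd = min (t + cd + (p - t)) (max (p + cd) K)"
    "min (p + bc) (q + ac) - t + ad = min (ad + bc + (p - t)) K"
    "min (p + bd) (q + ad) - t + ac = min (ac + bd + (p - t)) K"
    unfolding K_def by linarith+
  have "min_twice (max (p + cd) K) K K" by (simp add: min_twice_def)
  moreover have "min_twice (t + cd + (p - t)) (ad + bc + (p - t)) (ac + bd + (p - t))"
    unfolding min_twice_add using assms by (simp add: min_twice_ac)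
  ultimately have "min_twice (min (t + cd + (p - t)) (max (p + cd) K))
      (min (ad + bc + (p - t)) K) (min (ac + bd + (p - t)) K)"
    by (intro min_twice_min)
  then show ?thesis by (simp only: eq[symmetric])
qed

lemma min_twice_glue2: "min_twice (p + y) (q + z) (min (p + y) (q + z) - t + t)"
  unfolding min_twice_def by (intro conjI) linarith+

section \<open>Extending a tree by one vertex\<close>

lemma tree_onD:
  assumes "tree_on V D" "i \<in> V" "j \<in> V" "k \<in> V" "l \<in> V" "distinct [i, j, k, l]"
  shows "min_twice (D i j + D k l) (D i k + D j l) (D i l + D j k)"
  using assms unfolding tree_on_def by blast

lemma tree_on_insertI:
  assumes V: "tree_on V D" and x: "x \<notin> V"
    and sym: "\<And>i j. D' i j = D' j i"
    and old: "\<And>i j. i \<in> V \<Longrightarrow> j \<in> V \<Longrightarrow> D' i j = D i j"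
    and new: "\<And>i j k. \<lbrakk>i \<in> V; j \<in> V; k \<in> V; distinct [i, j, k]\<rbrakk> \<Longrightarrow>
      min_twice (D' x i + D j k) (D' x j + D i k) (D' x k + D i j)"
  shows "tree_on (insert x V) D'"
  unfolding tree_on_def
proof (intro conjI allI ballI impI)
  show "D' i j = D' j i" for i j by (rule sym)
  fix i j k l
  assume m: "i \<in> insert x V" "j \<in> insert x V" "k \<in> insert x V" "l \<in> insert x V"
    and d: "distinct [i, j, k, l]"
  consider "i \<in> V" "j \<in> V" "k \<in> V" "l \<in> V" | "i = x" "j \<in> V" "k \<in> V" "l \<in> V"
    | "i \<in> V" "j = x" "k \<in> V" "l \<in> V" | "i \<in> V" "j \<in> V" "k = x" "l \<in> V"
    | "i \<in> V" "j \<in> V" "k \<in> V" "l = x"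
    using m d x by auto
  then show "min_twice (D' i j + D' k l) (D' i k + D' j l) (D' i l + D' j k)"
  proof cases
    case 1
    then show ?thesis using tree_onD[OF V _ _ _ _ d] old by simp
  next
    case 2
    then show ?thesis using new[of j k l] d by (simp add: old)
  next
    case 3
    then show ?thesis using new[of i k l] d sym[of i x]
      by (simp add: old add.commute min_twice_ac)
  next
    case 4
    then show ?thesis using new[of i j l] d sym[of i x] sym[of j x]
      by (simp add: old add.commute min_twice_ac)
  next
    case 5
    then show ?thesis using new[of i j k] d sym[of i x] sym[of j x] sym[of k x]
      by (simp add: old add.commute min_twice_ac)
  qed
qed

text \<open>The new leaf is attached to the tree on the path between \<open>a\<close> and \<open>b\<close>.\<close>

lemma covers_glue:
  assumes sym: "\<And>i j. M i j = M j i" and cov: "covers V M E" and E: "E \<subseteq> V \<times> V"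
    and ab: "a \<in> V" "b \<in> V" "a \<noteq> b" "(a, b) \<in> E \<or> (b, a) \<in> E" and x: "x \<notin> V"
    and le: "\<And>c. c \<in> V - {a, b} \<Longrightarrow>
      M x c + M a b \<le> M x a + M b c \<and> M x c + M a b \<le> M x b + M a c"
  shows "covers (insert x V) M ({(x, a), (x, b)} \<union> E)"
proof -
  from cov obtain D where D: "tree_on V D" "\<And>i j. i \<in> V \<Longrightarrow> j \<in> V \<Longrightarrow> i \<noteq> j \<Longrightarrow> M i j \<le> D i j"
    "\<And>i j. (i, j) \<in> E \<Longrightarrow> D i j = M i j"
    unfolding covers_def by blast
  have Ds: "D i j = D j i" for i j using D(1) unfolding tree_on_def by blast
  have Dab: "D a b = M a b" using ab(4) D(3) sym[of a b] Ds[of a b] by auto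
  \<comment> \<open>The least value of \<open>g c\<close> that the four-point condition on x, a, b,
    c permits, given the prescribed entries at xa and xb.\<close>
  define g where "g c = (if c = a then M x a else if c = b then M x b
    else min (M x a + D b c) (M x b + D a c) - D a b)" for c
  define D' where "D' i j = (if i = x then g j else if j = x then g i else D i j)" for i j
  have xa: "x \<noteq> a" "x \<noteq> b" using ab x by auto
  have "tree_on (insert x V) D'"
  proof (rule tree_on_insertI[OF D(1) x])
    show "D' i j = D' j i" for i j by (auto simp: D'_def Ds)
    show "i \<in> V \<Longrightarrow> j \<in> V \<Longrightarrow> D' i j = D i j" for i j using x by (auto simp: D'_def)
    fix i j k assume V: "i \<in> V" "j \<in> V" "k \<in> V" and d: "distinct [i, j, k]"
    \<comment> \<open>Three kinds of triples: containing both a and b, exactly one of them, or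
      none.\<close>
    have two: "min_twice (g a + D b c) (g b + D a c) (g c + D a b)" if "c \<noteq> a" "c \<noteq> b" for c
      using that ab(3) min_twice_glue2[of "M x a" "D b c" "M x b" "D a c" "D a b"] by (simp add: g_def)
    have one: "min_twice (g a + D c d) (g c + D a d) (g d + D a c)"
      "min_twice (g b + D c d) (g c + D b d) (g d + D b c)"
      if "c \<in> V" "d \<in> V" "distinct [a, b, c, d]" for c d
    proof -
      note m = tree_onD[OF D(1) ab(1,2) that]
      then have m': "min_twice (D a b + D c d) (D b c + D a d) (D b d + D a c)"
        by (simp add: min_twice_ac add.commute)
      show "min_twice (g a + D c d) (g c + D a d) (g d + D a c)"
        using min_twice_glue1[OF m, of "M x a" "M x b"] that(3) by (auto simp: g_def)
      show "min_twice (g b + D c d) (g c + D b d) (g d + D b c)"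
        using min_twice_glue1[OF m', of "M x b" "M x a"] that(3) by (auto simp: g_def min.commute)
    qed
    have none: "min_twice (g c + D d e) (g d + D c e) (g e + D c d)"
      if "c \<in> V" "d \<in> V" "e \<in> V" "distinct [a, b, c, d, e]" for c d e
    proof -
      have "min_twice (D a c + D d e) (D a d + D c e) (D a e + D c d)"
        "min_twice (D b c + D d e) (D b d + D c e) (D b e + D c d)"
        using tree_onD[OF D(1) ab(1) that(1-3)] tree_onD[OF D(1) ab(2) that(1-3)] that(4) by auto
      from min_twice_glue0[OF this(2,1), of "M x a" "M x b" "D a b"]
      show ?thesis using that(4) by (auto simp: g_def)
    qed
    consider "distinct [a, b, i, j, k]" | "i = a" "j = b" | "i = b" "j = a" | "i = a" "k = b" | "i = b" "k = a"
      | "j = a" "k = b" | "j = b" "k = a"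
      | "i = a" "distinct [a, b, j, k]" | "j = a" "distinct [a, b, i, k]" | "k = a" "distinct [a, b, i, j]"
      | "i = b" "distinct [a, b, j, k]" | "j = b" "distinct [a, b, i, k]" | "k = b" "distinct [a, b, i, j]"
      using d ab(3) by auto
    then have "min_twice (g i + D j k) (g j + D i k) (g k + D i j)"
    proof cases
      case 1 show ?thesis by (rule none[OF V 1])
    next
      case 2 then show ?thesis using two[of k] d by auto
    next
      case 3 then show ?thesis using two[of k] d Ds[of b a] by (auto simp: min_twice_ac)
    next
      case 4 then show ?thesis using two[of j] d Ds[of j b] by (auto simp: min_twice_ac)
    next
      case 5 then show ?thesis using two[of j] d Ds[of j a] Ds[of b a] by (auto simp: min_twice_ac)
    next
      case 6 then show ?thesis using two[of i] d Ds[of i a] Ds[of i b] by (auto simp: min_twice_ac)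
    next
      case 7 then show ?thesis using two[of i] d Ds[of i a] Ds[of i b] Ds[of b a] by (auto simp: min_twice_ac)
    next
      case 8 then show ?thesis using one(1)[of j k] V by simp
    next
      case 9 then show ?thesis using one(1)[of i k] V Ds[of i a] by (auto simp: min_twice_ac)
    next
      case 10 then show ?thesis using one(1)[of i j] V Ds[of i a] Ds[of j a] by (auto simp: min_twice_ac)
    next
      case 11 then show ?thesis using one(2)[of j k] V by simp
    next
      case 12 then show ?thesis using one(2)[of i k] V Ds[of i b] by (auto simp: min_twice_ac)
    next
      case 13 then show ?thesis using one(2)[of i j] V Ds[of i b] Ds[of j b] by (auto simp: min_twice_ac)
    qed
    then show "min_twice (D' x i + D j k) (D' x j + D i k) (D' x k + D i j)"
      by (simp add: D'_def)
  qed
  moreover have g: "M x c \<le> g c" if "c \<in> V" for c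
  proof (cases "c = a \<or> c = b")
    case False
    then have "M a c \<le> D a c" "M b c \<le> D b c" using D(2) that ab by auto
    then show ?thesis using le[of c] that False Dab by (auto simp: g_def)
  qed (auto simp: g_def)
  have "M i j \<le> D' i j" if "i \<in> insert x V" "j \<in> insert x V" "i \<noteq> j" for i j
    using that g D(2) sym[of i x] by (auto simp: D'_def)
  moreover have "D' i j = M i j" if "(i, j) \<in> {(x, a), (x, b)} \<union> E" for i j
    using that E x xa ab D(3) by (auto simp: D'_def g_def)
  ultimately show ?thesis unfolding covers_def by blast
qed

text \<open>The new vertex becomes a twin of an old vertex \<open>a\<close>: its row is the row of
  \<open>a\<close> shifted by a constant, so quadruples avoiding \<open>a\<close> inherit their
  condition from \<open>a\<close>.\<close>

lemma covers_extend1: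
  assumes sym: "\<And>i j. M i j = M j i" and cov: "covers V M E" and E: "E \<subseteq> V \<times> V"
    and V: "finite V" "V \<noteq> {}" and x: "x \<notin> V"
  shows "covers (insert x V) M E"
proof -
  from cov obtain D where D: "tree_on V D" "\<And>i j. i \<in> V \<Longrightarrow> j \<in> V \<Longrightarrow> i \<noteq> j \<Longrightarrow> M i j \<le> D i j"
    "\<And>i j. (i, j) \<in> E \<Longrightarrow> D i j = M i j"
    unfolding covers_def by blast
  have Ds: "D i j = D j i" for i j using D(1) unfolding tree_on_def by blast
  obtain a where a: "a \<in> V" using V by blast
  \<comment> \<open>\<open>K\<close> lifts the copied row above \<open>M\<close>. In a quadruple
    with x and \<open>a\<close>, two sums coincide by construction, and \<open>L\<close> keeps the
    third one from falling below them.\<close>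
  define K where "K = Max ((\<lambda>c. M x c - D a c) ` V)"
  define L where "L = Max ((\<lambda>(c, d). D a c + D a d - D c d + K) ` (V \<times> V))"
  have K: "M x c \<le> D a c + K" if "c \<in> V" for c
    using that V Max_ge[of "(\<lambda>c. M x c - D a c) ` V" "M x c - D a c"]
    by (simp add: K_def algebra_simps)
  have L: "D a c + D a d + K \<le> D c d + L" if "c \<in> V" "d \<in> V" for c d
    using that V Max_ge[of "(\<lambda>(c, d). D a c + D a d - D c d + K) ` (V \<times> V)" "D a c + D a d - D c d + K"]
    by (force simp: L_def algebra_simps)
  define g where "g c = (if c = a then max L (M x a) else D a c + K)" for c
  define D' where "D' i j = (if i = x then g j else if j = x then g i else D i j)" for i j
  have "tree_on (insert x V) D'"
  proof (rule tree_on_insertI[OF D(1) x])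
    show "D' i j = D' j i" for i j by (auto simp: D'_def Ds)
    show "i \<in> V \<Longrightarrow> j \<in> V \<Longrightarrow> D' i j = D i j" for i j using x by (auto simp: D'_def)
    fix i j k assume m: "i \<in> V" "j \<in> V" "k \<in> V" and d: "distinct [i, j, k]"
    consider "i = a" | "j = a" | "k = a" | "distinct [a, i, j, k]" using d by auto
    then have "min_twice (g i + D j k) (g j + D i k) (g k + D i j)"
    proof cases
      case 1 then show ?thesis using L[of j k] m d by (auto simp: g_def min_twice_def algebra_simps)
    next
      case 2 then show ?thesis using L[of i k] m d Ds by (auto simp: g_def min_twice_def algebra_simps)
    next
      case 3 then show ?thesis using L[of i j] m d Ds by (auto simp: g_def min_twice_def algebra_simps)
    next
      case 4 then show ?thesis using tree_onD[OF D(1) a m] by (auto simp: g_def min_twice_def)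
    qed
    then show "min_twice (D' x i + D j k) (D' x j + D i k) (D' x k + D i j)"
      by (simp add: D'_def)
  qed
  moreover have "M i j \<le> D' i j" if "i \<in> insert x V" "j \<in> insert x V" "i \<noteq> j" for i j
    using that K D(2) sym[of i x] by (auto simp: D'_def g_def)
  moreover have "D' i j = M i j" if "(i, j) \<in> E" for i j
    using that E x D(3) by (auto simp: D'_def)
  ultimately show ?thesis unfolding covers_def by blast
qed

lemma covers_extend:
  assumes sym: "\<And>i j. M i j = M j i" and cov: "covers V M E" and E: "E \<subseteq> V \<times> V"
    and V: "V \<noteq> {}" "V \<subseteq> W" and W: "finite W"
  shows "covers W M E"
proof -
  have fV: "finite V" using V W finite_subset by blast
  have "covers (V \<union> A) M E" if "finite A" for A
    using that
  proof induction
    case (insert x A)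
    show ?case
    proof (cases "x \<in> V")
      case False
      then have "x \<notin> V \<union> A" using insert by auto
      moreover have "E \<subseteq> (V \<union> A) \<times> (V \<union> A)" using E by auto
      ultimately show ?thesis
        using covers_extend1[OF sym, where V = "V \<union> A" and E = E and x = x] insert fV V by auto
    qed (use insert in \<open>simp add: insert_absorb\<close>)
  qed (use cov in simp)
  from this[of W] show ?thesis using V W by (simp add: Un_absorb1)
qed

section \<open>Trees on a quadruple and trees containing a full star\<close>

text \<open>Raise the entries at ac and ad just enough that their sums reach
  \<open>M a b + M c d\<close>. As this pairing is not the strict minimum, at least one of the two
  sums then equals it and neither is smaller.\<close>

lemma covers_four:
  assumes sym: "\<And>i j. M i j = M j i" and d: "distinct [a, b, c, d]"
    and "\<not> (M a b + M c d < M a c + M b d \<and> M a b + M c d < M a d + M b c)"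
  shows "covers {a, b, c, d} M {(a, b), (c, d), (b, c), (b, d)}"
proof -
  define s where "s = M a b + M c d"
  define D where "D i j = (if {i, j} = {a, c} then max (M a c) (s - M b d)
    else if {i, j} = {a, d} then max (M a d) (s - M b c) else M i j)" for i j
  have Ds: "D i j = D j i" for i j unfolding D_def by (simp add: insert_commute sym)
  have v: "D a b = M a b" "D c d = M c d" "D b c = M b c" "D b d = M b d"
     "D a c = max (M a c) (s - M b d)" "D a d = max (M a d) (s - M b c)"
    using d by (auto simp: D_def doubleton_eq_iff)
  have m: "min_twice (D a b + D c d) (D a c + D b d) (D a d + D b c)"
    using assms(3) by (auto simp: v min_twice_def s_def)
  have m': "min_twice (D a b + D d c) (D a c + D d b) (D a d + D c b)"
    using m Ds by (simp add: min_twice_ac)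
  have "tree_on (insert a {b, c, d}) D"
  proof (rule tree_on_insertI)
    show "tree_on {b, c, d} D" using Ds by (auto simp: tree_on_def)
    show "min_twice (D a i + D j k) (D a j + D i k) (D a k + D i j)"
      if "i \<in> {b, c, d}" "j \<in> {b, c, d}" "k \<in> {b, c, d}" "distinct [i, j, k]" for i j k
      using that m m' by (auto simp: min_twice_ac Ds)
  qed (use d Ds in auto)
  moreover have "M i j \<le> D i j" for i j
    using d sym by (auto simp: D_def doubleton_eq_iff)
  ultimately show ?thesis unfolding covers_def using v by auto
qed

text \<open>In coordinates where the star at \<open>v\<close> is zero, trees containing it are ultrametrics on the
  remaining vertices; the bottleneck ultrametric of \<open>w\<close> agrees with \<open>w\<close> on every pair that is
  maximal across some cut.\<close>

definition link :: "('a \<Rightarrow> 'a \<Rightarrow> real) \<Rightarrow> 'a \<Rightarrow> 'a \<Rightarrow> 'a \<Rightarrow> real" where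
  "link M v i j = M i j - M v i - M v j"

lemma covers_star_cut:
  assumes sym: "\<And>i j. M i j = M j i" and U: "finite U" and v: "v \<notin> U"
  shows "covers (insert v U) M ({v} \<times> U \<union> {(i, j). i \<in> U \<and> j \<in> U \<and> i \<noteq> j \<and>
    (\<exists>S. i \<in> S \<and> j \<notin> S \<and> (\<forall>k\<in>U \<inter> S. \<forall>l\<in>U - S. link M v k l \<le> link M v i j))})"
proof -
  \<comment> \<open>\<open>u i j\<close> is the widest-path value: the largest threshold at which i
    and j are joined by link edges of at least that weight. Thresholds range over the finite set
    \<open>W\<close> of link values.\<close>
  define R where "R t = {(k, l). k \<in> U \<and> l \<in> U \<and> t \<le> link M v k l}\<^sup>*" for t
  define W where "W = (\<lambda>(k, l). link M v k l) ` (U \<times> U)"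
  define u where "u i j = Max {t \<in> W. (i, j) \<in> R t}" for i j
  have ws: "link M v k l = link M v l k" for k l using sym by (simp add: link_def)
  have fW: "finite W" using U by (simp add: W_def)
  have R_mono: "(i, j) \<in> R t" if "(i, j) \<in> R s" "t \<le> s" for i j s t
    using that rtrancl_mono[of "{(k, l). k \<in> U \<and> l \<in> U \<and> s \<le> link M v k l}"
        "{(k, l). k \<in> U \<and> l \<in> U \<and> t \<le> link M v k l}"]
    unfolding R_def by force
  have R_sym: "(i, j) \<in> R t \<longleftrightarrow> (j, i) \<in> R t" for i j t
    unfolding R_def by (intro iffI; rule symD[OF sym_rtrancl]) (auto simp: sym_def ws)
  have us: "u i j = u j i" for i j unfolding u_def using R_sym by simp
  have base: "link M v i j \<in> {t \<in> W. (i, j) \<in> R t}" if "i \<in> U" "j \<in> U" for i j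
    using that by (auto simp: W_def R_def intro!: r_into_rtrancl)
  have u_ge: "t \<le> u i j" if "t \<in> W" "(i, j) \<in> R t" for i j t
    unfolding u_def using that fW by (intro Max_ge) auto
  have u_in: "u i j \<in> W \<and> (i, j) \<in> R (u i j)" if "i \<in> U" "j \<in> U" for i j
    using Max_in[of "{t \<in> W. (i, j) \<in> R t}"] base[OF that] fW unfolding u_def by auto
  have w_le_u: "link M v i j \<le> u i j" if "i \<in> U" "j \<in> U" for i j
    using base[OF that] u_ge by auto
  have ultra: "min (u i j) (u j k) \<le> u i k" if "i \<in> U" "j \<in> U" "k \<in> U" for i j k
  proof (rule u_ge)
    show "min (u i j) (u j k) \<in> W" using u_in that by (simp add: min_def)
    have "(i, j) \<in> R (min (u i j) (u j k))"
      by (rule R_mono[where s = "u i j"]) (use u_in that in auto)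
    moreover have "(j, k) \<in> R (min (u i j) (u j k))"
      by (rule R_mono[where s = "u j k"]) (use u_in that in auto)
    ultimately show "(i, k) \<in> R (min (u i j) (u j k))" unfolding R_def by (rule rtrancl_trans)
  qed
  \<comment> \<open>Ultrametrics satisfy the four-point condition: \<open>u i j\<close> is bounded
    below through k and through l, and \<open>u k l\<close> through i and through j.\<close>
  have four: "min (u i k + u j l) (u i l + u j k) \<le> u i j + u k l"
    if "i \<in> U" "j \<in> U" "k \<in> U" "l \<in> U" for i j k l
    using ultra[OF that(1,3,2)] ultra[OF that(1,4,2)] ultra[OF that(3,1,4)] ultra[OF that(3,2,4)]
    unfolding us[of k j] us[of l j] us[of k i] min_le_iff_disj by linarith
  \<comment> \<open>A path from i to j has to leave S, and an edge leaving S weighs at most as much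
    as the pair i, j.\<close>
  have cut: "u i j \<le> link M v i j" if "i \<in> U" "j \<in> U" "i \<in> S" "j \<notin> S"
    and S: "\<And>k l. k \<in> U \<inter> S \<Longrightarrow> l \<in> U - S \<Longrightarrow> link M v k l \<le> link M v i j" for i j S
  proof -
    have "l \<in> S \<or> t \<le> link M v i j" if "(i, l) \<in> R t" for t l
      using that unfolding R_def
    proof induction
      case (step y z)
      then show ?case using S[of y z] by (cases "y \<in> S"; cases "z \<in> S") auto
    qed (use \<open>i \<in> S\<close> in simp)
    then show ?thesis using u_in that by blast
  qed
  \<comment> \<open>Undoes the normalisation in \<open>link\<close>; this shifts the three sums of a
    quadruple by the same amount.\<close>
  define D where "D i j = (if i = v then M v j else if j = v then M v i
    else u i j + M v i + M v j)" for i j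
  have "tree_on (insert v U) D"
  proof (rule tree_on_insertI)
    show "D i j = D j i" for i j using us by (simp add: D_def)
    show "tree_on U D"
      unfolding tree_on_def
    proof (intro conjI allI ballI impI)
      fix i j k l assume m: "i \<in> U" "j \<in> U" "k \<in> U" "l \<in> U"
      define s where "s = M v i + M v j + M v k + M v l"
      have "D i j + D k l = u i j + u k l + s" "D i k + D j l = u i k + u j l + s"
        "D i l + D j k = u i l + u j k + s"
        using m v by (auto simp: D_def s_def)
      moreover have "min_twice (u i j + u k l) (u i k + u j l) (u i l + u j k)"
        unfolding min_twice_def
      proof (intro conjI)
        show "min (u i k + u j l) (u i l + u j k) \<le> u i j + u k l"
          using four[OF m] .
        show "min (u i j + u k l) (u i l + u j k) \<le> u i k + u j l"
          using four[OF m(1,3,2,4)] us[of k j] by simp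
        show "min (u i j + u k l) (u i k + u j l) \<le> u i l + u j k"
          using four[OF m(1,4,2,3)] us[of l j] us[of l k] us[of k j] by simp
      qed
      ultimately show "min_twice (D i j + D k l) (D i k + D j l) (D i l + D j k)"
        by (simp only: min_twice_add)
    qed (simp add: D_def us)
    show "min_twice (D v i + D j k) (D v j + D i k) (D v k + D i j)"
      if m: "i \<in> U" "j \<in> U" "k \<in> U" for i j k
    proof -
      define s where "s = M v i + M v j + M v k"
      have "D v i + D j k = u j k + s" "D v j + D i k = u i k + s" "D v k + D i j = u i j + s"
        using m v by (auto simp: D_def s_def)
      moreover have "min_twice (u j k) (u i k) (u i j)"
        unfolding min_twice_def using ultra[OF m] ultra[OF m(1,3,2)] ultra[OF m(2,1,3)] us
        by (simp add: min.commute)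
      ultimately show ?thesis by (simp only: min_twice_add)
    qed
  qed (use v in auto)
  moreover have "M i j \<le> D i j" if "i \<in> insert v U" "j \<in> insert v U" "i \<noteq> j" for i j
    using that w_le_u[of i j] sym[of i v] by (auto simp: D_def link_def)
  moreover have "D i j = M i j" if "i \<in> U" "j \<in> U" "i \<in> S" "j \<notin> S"
    and S: "\<And>k l. k \<in> U \<inter> S \<Longrightarrow> l \<in> U - S \<Longrightarrow> link M v k l \<le> link M v i j" for i j S
    using cut[OF that] w_le_u[of i j] that v by (auto simp: D_def link_def)
  moreover have "D v j = M v j" for j by (simp add: D_def)
  ultimately show ?thesis
    unfolding covers_def by (intro exI[of _ D] conjI ballI) auto
qed

lemma covers_mono: "covers V M E \<Longrightarrow> E' \<subseteq> E \<Longrightarrow> covers V M E'"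
  unfolding covers_def by (meson subset_iff)

lemma covers_flip:
  assumes "covers V M E" "E' \<subseteq> E \<union> E\<inverse>" and sym: "\<And>i j. M i j = M j i"
  shows "covers V M E'"
proof -
  from assms(1) obtain D where D: "tree_on V D" "\<forall>i\<in>V. \<forall>j\<in>V. i \<noteq> j \<longrightarrow> M i j \<le> D i j"
    "\<And>i j. (i, j) \<in> E \<Longrightarrow> D i j = M i j"
    unfolding covers_def by blast
  have "D i j = M i j" if "(i, j) \<in> E'" for i j
    using that assms(2) D(1) D(3)[of i j] D(3)[of j i] sym[of i j] by (auto simp: tree_on_def)
  then show ?thesis unfolding covers_def using D(1,2) by blast
qed

lemma covers_star:
  assumes sym: "\<And>i j. M i j = M j i" and V: "finite V" "v \<in> V" "U \<subseteq> V - {v}"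
  shows "covers V M ({v} \<times> U)"
proof -
  have "covers (insert v (V - {v})) M ({v} \<times> U)"
    by (rule covers_mono[OF covers_star_cut[OF sym]]) (use V in auto)
  then show ?thesis using V by (simp add: insert_absorb)
qed

text \<open>Three vertices carry no four-point condition, so \<open>M\<close> itself is a tree on
  them.\<close>

lemma covers_triangle:
  assumes sym: "\<And>i j. M i j = M j i" and V: "finite V" "{a, b, c} \<subseteq> V"
  shows "covers V M {(a, b), (a, c), (b, c)}"
proof (rule covers_extend[OF sym])
  show "covers {a, b, c} M {(a, b), (a, c), (b, c)}"
    unfolding covers_def tree_on_def by (intro exI[of _ M]) (auto simp: sym)
qed (use V in auto)

section \<open>Three covers on six vertices and their obstructions\<close>

text \<open>The obstruction to \<open>covers_quad\<close>. Its weak counterpart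
  \<open>weak_min\<close> below is the condition for gluing a leaf in
  \<open>covers_glue\<close>.\<close>

definition strict_min :: "('a \<Rightarrow> 'a \<Rightarrow> real) \<Rightarrow> 'a \<Rightarrow> 'a \<Rightarrow> 'a \<Rightarrow> 'a \<Rightarrow> bool" where
  "strict_min M a b c d \<longleftrightarrow> M a b + M c d < M a c + M b d \<and> M a b + M c d < M a d + M b c"

definition weak_min :: "('a \<Rightarrow> 'a \<Rightarrow> real) \<Rightarrow> 'a \<Rightarrow> 'a \<Rightarrow> 'a \<Rightarrow> 'a \<Rightarrow> bool" where
  "weak_min M a b c d \<longleftrightarrow> M a b + M c d \<le> M a c + M b d \<and> M a b + M c d \<le> M a d + M b c"

lemma covers_quad:
  assumes sym: "\<And>i j. M i j = M j i" and d: "distinct [a, b, c, d]"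
    and "\<not> strict_min M a b c d" and V: "finite V" "{a, b, c, d} \<subseteq> V"
  shows "covers V M {(a, b), (c, d), (b, c), (b, d)}"
proof (rule covers_extend[OF sym])
  show "covers {a, b, c, d} M {(a, b), (c, d), (b, c), (b, d)}"
    using assms(3) by (intro covers_four[OF sym d]) (simp add: strict_min_def)
qed (use V in auto)

lemma covered_by_threeI:
  assumes "covers V M E1" "covers V M E2" "covers V M E3"
    and "\<And>i j. i \<in> V \<Longrightarrow> j \<in> V \<Longrightarrow> i \<noteq> j \<Longrightarrow>
      (i, j) \<in> E1 \<union> E2 \<union> E3 \<or> (j, i) \<in> E1 \<union> E2 \<union> E3"
  shows "covered_by 3 V M"
  unfolding covered_by_def
proof (intro exI[of _ "(!) [E1, E2, E3]"] conjI allI ballI impI)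
  let ?E = "(!) [E1, E2, E3]"
  show "covers V M (?E s)" if "s < 3" for s
    using that assms(1-3) by (auto simp: numeral_3_eq_3 less_Suc_eq)
  show "\<exists>s<3. (i, j) \<in> ?E s \<or> (j, i) \<in> ?E s" if "i \<in> V" "j \<in> V" "i \<noteq> j" for i j
    using assms(4)[OF that] by (auto simp: numeral_3_eq_3 less_Suc_eq conj_disj_distribR ex_disj_distrib)
qed

lemma covered_by_sixI:
  assumes "covers {a, b, c, d, e, f} M E1" "covers {a, b, c, d, e, f} M E2"
    "covers {a, b, c, d, e, f} M E3"
    and E: "{(a, b), (a, c), (a, d), (a, e), (a, f), (b, c), (b, d), (b, e), (b, f),
      (c, d), (c, e), (c, f), (d, e), (d, f), (e, f)} \<subseteq> (E1 \<union> E2 \<union> E3) \<union> (E1 \<union> E2 \<union> E3)\<inverse>"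
  shows "covered_by 3 {a, b, c, d, e, f} M"
proof (rule covered_by_threeI[OF assms(1-3)])
  define F where "F = (E1 \<union> E2 \<union> E3) \<union> (E1 \<union> E2 \<union> E3)\<inverse>"
  have F: "(i, j) \<in> F \<longleftrightarrow> (j, i) \<in> F" for i j by (auto simp: F_def)
  have E: "(a, b) \<in> F" "(a, c) \<in> F" "(a, d) \<in> F" "(a, e) \<in> F" "(a, f) \<in> F" "(b, c) \<in> F"
    "(b, d) \<in> F" "(b, e) \<in> F" "(b, f) \<in> F" "(c, d) \<in> F" "(c, e) \<in> F" "(c, f) \<in> F"
    "(d, e) \<in> F" "(d, f) \<in> F" "(e, f) \<in> F"
    using E by (simp_all add: F_def)
  note E' = E[THEN iffD1[OF F]]
  fix i j assume "i \<in> {a, b, c, d, e, f}" "j \<in> {a, b, c, d, e, f}" "i \<noteq> j"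
  then have "(i, j) \<in> F"
    by (elim insertE emptyE) (simp_all add: E E')
  then show "(i, j) \<in> E1 \<union> E2 \<union> E3 \<or> (j, i) \<in> E1 \<union> E2 \<union> E3" by (auto simp: F_def)
qed

text \<open>The conditions involving \<open>v\<close> hold if \<open>a b c d e\<close> is a maximal spanning tree of the
  link of \<open>v\<close>; the strict minima are the obstructions to finishing with the star at \<open>e\<close>, \<open>a\<close>, \<open>b\<close>
  and \<open>d\<close>, respectively.\<close>

definition path_type :: "('a \<Rightarrow> 'a \<Rightarrow> real) \<Rightarrow> 'a \<Rightarrow> 'a \<Rightarrow> 'a \<Rightarrow> 'a \<Rightarrow> 'a \<Rightarrow> 'a \<Rightarrow> bool" where
  "path_type M v a b c d e \<longleftrightarrow>
     weak_min M a c b v \<and> weak_min M b d c v \<and> weak_min M c e d v \<and>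
     M a d + M v b \<le> M a b + M v d \<and> M a d + M v c \<le> M c d + M v a \<and>
     M b e + M v c \<le> M b c + M v e \<and> M b e + M v d \<le> M d e + M v b \<and>
     M a e + M v b \<le> M a b + M v e \<and> M a e + M v d \<le> M d e + M v a \<and>
     strict_min M a c b d \<and> strict_min M b d c e \<and> strict_min M a d c e \<and> strict_min M b e a c"

text \<open>Among c, x, y, z, t, the pairs other than cy, cz, ct lie in the star at x or the
  triangle y z t.\<close>

lemma covered_by_branch:
  assumes sym: "\<And>i j. M i j = M j i" and d: "distinct [v, c, x, y, z, t]"
    and cov: "covers {v, c, x, y, z, t} M ({v} \<times> {c, x, y, z, t} \<union> {(c, y), (c, z), (c, t)})"
  shows "covered_by 3 {v, c, x, y, z, t} M"
proof (rule covered_by_sixI[OF cov])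
  show "covers {v, c, x, y, z, t} M ({x} \<times> {c, y, z, t})"
    using d by (intro covers_star[OF sym]) auto
  show "covers {v, c, x, y, z, t} M {(y, z), (y, t), (z, t)}"
    by (rule covers_triangle[OF sym]) auto
qed (rule subsetI, elim insertE emptyE; simp)

text \<open>The first tree misses ac, ad, ae, bd, be, ce. After removing the star at e, a, b or d,
  the missed pairs lie in a single quadruple and avoid two of its pairs, so
  \<open>covers_quad\<close> applies unless the corresponding strict minimum occurs.\<close>

lemma covered_by_or_path_type:
  assumes sym: "\<And>i j. M i j = M j i" and dist: "distinct [v, a, b, c, d, e]"
    and cov: "covers {v, a, b, c, d, e} M
      ({v} \<times> {a, b, c, d, e} \<union> {(a, b), (b, c), (c, d), (d, e)})"
    and le: "link M v a c \<le> link M v a b" "link M v a c \<le> link M v b c"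
      "link M v b d \<le> link M v b c" "link M v b d \<le> link M v c d"
      "link M v c e \<le> link M v c d" "link M v c e \<le> link M v d e"
      "link M v a d \<le> link M v a b" "link M v a d \<le> link M v c d"
      "link M v b e \<le> link M v b c" "link M v b e \<le> link M v d e"
      "link M v a e \<le> link M v a b" "link M v a e \<le> link M v d e"
  shows "covered_by 3 {v, a, b, c, d, e} M \<or> path_type M v a b c d e"
proof (rule disjCI, rule ccontr)
  let ?V = "{v, a, b, c, d, e}"
  assume not_path: "\<not> path_type M v a b c d e" and no: "\<not> covered_by 3 ?V M"
  have star: "covers ?V M ({x} \<times> (?V - {x}))" if "x \<in> ?V" for x
    using that by (intro covers_star[OF sym]) auto
  have "strict_min M d b e c"
  proof (rule ccontr)
    assume "\<not> strict_min M d b e c"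
    then have quad: "covers ?V M {(d, b), (e, c), (b, e), (b, c)}"
      using dist by (intro covers_quad[OF sym]) auto
    have "covered_by 3 ?V M"
    proof (rule covered_by_sixI[OF cov star quad])
      show "a \<in> ?V" by simp
    qed (rule subsetI, elim insertE emptyE; use dist in auto)
    then show False using no by simp
  qed
  moreover have "strict_min M b d a c"
  proof (rule ccontr)
    assume "\<not> strict_min M b d a c"
    then have quad: "covers ?V M {(b, d), (a, c), (d, a), (d, c)}"
      using dist by (intro covers_quad[OF sym]) auto
    have "covered_by 3 ?V M"
    proof (rule covered_by_sixI[OF cov star quad])
      show "e \<in> ?V" by simp
    qed (rule subsetI, elim insertE emptyE; use dist in auto)
    then show False using no by simp
  qed
  moreover have "strict_min M d a c e"
  proof (rule ccontr)
    assume "\<not> strict_min M d a c e"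
    then have quad: "covers ?V M {(d, a), (c, e), (a, c), (a, e)}"
      using dist by (intro covers_quad[OF sym]) auto
    have "covered_by 3 ?V M"
    proof (rule covered_by_sixI[OF cov star quad])
      show "b \<in> ?V" by simp
    qed (rule subsetI, elim insertE emptyE; use dist in auto)
    then show False using no by simp
  qed
  moreover have "strict_min M b e a c"
  proof (rule ccontr)
    assume "\<not> strict_min M b e a c"
    then have quad: "covers ?V M {(b, e), (a, c), (e, a), (e, c)}"
      using dist by (intro covers_quad[OF sym]) auto
    have "covered_by 3 ?V M"
    proof (rule covered_by_sixI[OF cov star quad])
      show "d \<in> ?V" by simp
    qed (rule subsetI, elim insertE emptyE; use dist in auto)
    then show False using no by simp
  qed
  \<comment> \<open>Comparing two link values at a common vertex amounts to comparing two of the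
    sums of a quadruple through v.\<close>
  ultimately have "path_type M v a b c d e"
    using le unfolding path_type_def weak_min_def strict_min_def link_def by (simp add: sym)
  then show False using not_path by simp
qed

section \<open>Maximal spanning trees of the link\<close>

lemma finite_pairs_max:
  fixes f :: "'a \<Rightarrow> 'b \<Rightarrow> real"
  assumes "finite P" "P \<noteq> {}"
  shows "\<exists>a b. (a, b) \<in> P \<and> (\<forall>c d. (c, d) \<in> P \<longrightarrow> f c d \<le> f a b)"
proof -
  have "finite ((\<lambda>(a, b). f a b) ` P)" "(\<lambda>(a, b). f a b) ` P \<noteq> {}" using assms by auto
  from Max_in[OF this] obtain a b where "(a, b) \<in> P" "f a b = Max ((\<lambda>(a, b). f a b) ` P)" by auto
  moreover have "f c d \<le> Max ((\<lambda>(a, b). f a b) ` P)" if "(c, d) \<in> P" for c d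
    using that assms by (intro Max_ge) force+
  ultimately show ?thesis by metis
qed

lemma link_sym: "(\<And>i j. M i j = M j i) \<Longrightarrow> link M v i j = link M v j i"
  by (simp add: link_def)

text \<open>Kruskal's first edge followed by Prim's algorithm produces a maximal spanning tree of the
  link of \<open>v\<close>. A spanning tree on five vertices is a path or has a vertex of degree at least 3.\<close>

lemma covered_or_path_type_at:
  fixes M :: "'a \<Rightarrow> 'a \<Rightarrow> real"
  assumes sym: "\<And>i j. M i j = M j i" and V: "finite V" "card V = 6" "v \<in> V"
  shows "covered_by 3 V M \<or> (\<exists>a b c d e. distinct [v, a, b, c, d, e] \<and> V = {v, a, b, c, d, e} \<and>
    path_type M v a b c d e)"
proof -
  define w where "w = link M v"
  have ws: "w i j = w j i" for i j unfolding w_def by (rule link_sym[OF sym])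
  define U where "U = V - {v}"
  have U: "finite U" "card U = 5" using V by (auto simp: U_def)
  obtain i where i: "i \<in> U" using U by fastforce
  then have "card (U - {i}) = 4" using U by simp
  then have "U - {i} \<noteq> {}"
    by (metis card.empty zero_neq_numeral)
  then obtain j where "j \<in> U" "j \<noteq> i" by blast
  with i have ne: "{(i, j). i \<in> U \<and> j \<in> U \<and> i \<noteq> j} \<noteq> {}" by blast
  have fin: "finite {(i, j). i \<in> U \<and> j \<in> U \<and> i \<noteq> j}"
    by (rule finite_subset[of _ "U \<times> U"]) (use U in auto)
  from finite_pairs_max[OF fin ne, of w] obtain p0 q0 where pq0': "(p0, q0) \<in> {(i, j). i \<in> U \<and> j \<in> U \<and> i \<noteq> j}"
    "\<forall>i j. (i, j) \<in> {(i, j). i \<in> U \<and> j \<in> U \<and> i \<noteq> j} \<longrightarrow> w i j \<le> w p0 q0"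
    by (elim exE conjE)
  then have pq0: "p0 \<in> U" "q0 \<in> U" "p0 \<noteq> q0"
    "\<And>i j. i \<in> U \<Longrightarrow> j \<in> U \<Longrightarrow> i \<noteq> j \<Longrightarrow> w i j \<le> w p0 q0"
    by blast+
  have "card (U - {p0, q0}) = 3" using U pq0 by (simp add: card_Diff_subset)
  then have ne: "{p0, q0} \<times> (U - {p0, q0}) \<noteq> {}"
    by (metis card.empty zero_neq_numeral Times_empty insert_not_empty)
  have fin: "finite ({p0, q0} \<times> (U - {p0, q0}))" using U(1) by simp
  from finite_pairs_max[OF fin ne, of w] obtain q r where "(q, r) \<in> {p0, q0} \<times> (U - {p0, q0})"
    "\<forall>i j. (i, j) \<in> {p0, q0} \<times> (U - {p0, q0}) \<longrightarrow> w i j \<le> w q r"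
    by (elim exE conjE)
  then have qr: "q \<in> {p0, q0}" "r \<in> U" "r \<notin> {p0, q0}"
    "\<And>i j. i \<in> {p0, q0} \<Longrightarrow> j \<in> U - {p0, q0} \<Longrightarrow> w i j \<le> w q r"
    by blast+
  \<comment> \<open>The second edge leaves an end of the first one; that end is q and the other is
    p, so the tree starts as the path p q r.\<close>
  define p where "p = (if q = p0 then q0 else p0)"
  have pq: "{p0, q0} = {p, q}" "p \<noteq> q" "w p0 q0 = w p q"
    using qr pq0 ws by (auto simp: p_def)
  have pqU: "p \<in> U" "q \<in> U" using pq0(1,2) qr(1) by (auto simp: p_def)
  have rpq: "r \<notin> {p, q}" using qr(3) pq(1) by simp
  have "card {p, q, r} = 3" using rpq pq(2) by (auto simp: card_insert_if)
  then have c2: "card (U - {p, q, r}) = 2"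
    using U pqU qr(2) by (simp add: card_Diff_subset)
  then have ne: "{p, q, r} \<times> (U - {p, q, r}) \<noteq> {}"
    by (metis card.empty zero_neq_numeral Times_empty insert_not_empty)
  have fin: "finite ({p, q, r} \<times> (U - {p, q, r}))" using U(1) by simp
  from finite_pairs_max[OF fin ne, of w] obtain s x where "(s, x) \<in> {p, q, r} \<times> (U - {p, q, r})"
    "\<forall>i j. (i, j) \<in> {p, q, r} \<times> (U - {p, q, r}) \<longrightarrow> w i j \<le> w s x"
    by (elim exE conjE)
  then have sx: "s \<in> {p, q, r}" "x \<in> U" "x \<notin> {p, q, r}"
    "\<And>i j. i \<in> {p, q, r} \<Longrightarrow> j \<in> U - {p, q, r} \<Longrightarrow> w i j \<le> w s x"
    by blast+
  have "card (U - {p, q, r} - {x}) = 1" using c2 sx(2,3) U(1) by simp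
  then obtain y where y: "U - {p, q, r} - {x} = {y}" by (auto simp: card_1_singleton_iff)
  have "y \<in> U - {p, q, r} - {x}" unfolding y by simp
  then have yU: "y \<in> U" "y \<notin> {p, q, r, x}" by simp_all
  have U_eq: "U = {p, q, r, x, y}" using y pqU qr(2) sx(2) by blast
  have "v \<notin> U" by (simp add: U_def)
  then have dist: "distinct [v, p, q, r, x, y]"
    using yU pqU qr(2) rpq sx(2,3) pq(2) by auto
  have fin: "finite ({p, q, r, x} \<times> {y})" and ne: "{p, q, r, x} \<times> {y} \<noteq> {}" by simp_all
  from finite_pairs_max[OF fin ne, of w] obtain t y' where "(t, y') \<in> {p, q, r, x} \<times> {y}"
    "\<forall>i j. (i, j) \<in> {p, q, r, x} \<times> {y} \<longrightarrow> w i j \<le> w t y'"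
    by (elim exE conjE)
  then have t: "t \<in> {p, q, r, x}" "\<And>i. i \<in> {p, q, r, x} \<Longrightarrow> w i y \<le> w t y"
    by blast+
  have V_eq: "V = {v, p, q, r, x, y}" using U_eq V(3) unfolding U_def by blast
  \<comment> \<open>Each chosen edge is maximal across the cut between the vertices already reached
    and the rest (for pq, the cut around p), hence is covered by the bottleneck tree.\<close>
  have cut: "(i, j) \<in> {(i, j). i \<in> U \<and> j \<in> U \<and> i \<noteq> j \<and> (\<exists>S. i \<in> S \<and> j \<notin> S \<and>
      (\<forall>k\<in>U \<inter> S. \<forall>l\<in>U - S. link M v k l \<le> link M v i j))}"
    if "i \<in> S" "j \<notin> S" "i \<in> U" "j \<in> U" "\<And>k l. k \<in> U \<inter> S \<Longrightarrow> l \<in> U - S \<Longrightarrow> w k l \<le> w i j"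
    for i j S
    using that unfolding w_def by auto
  let ?T = "{(p, q), (q, r), (s, x), (t, y)}"
  have "covers (insert v U) M ({v} \<times> U \<union> ?T)"
  proof (rule covers_mono[OF covers_star_cut[OF sym U(1)]])
    have "(p, q) \<in> {(i, j). i \<in> U \<and> j \<in> U \<and> i \<noteq> j \<and> (\<exists>S. i \<in> S \<and> j \<notin> S \<and>
      (\<forall>k\<in>U \<inter> S. \<forall>l\<in>U - S. link M v k l \<le> link M v i j))}"
      by (rule cut[of _ "{p}"]) (use pq0(4) pq(2,3) pqU in auto)
    moreover have "(q, r) \<in> {(i, j). i \<in> U \<and> j \<in> U \<and> i \<noteq> j \<and> (\<exists>S. i \<in> S \<and> j \<notin> S \<and>
      (\<forall>k\<in>U \<inter> S. \<forall>l\<in>U - S. link M v k l \<le> link M v i j))}"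
      by (rule cut[of _ "{p, q}"]) (use qr(2,4) rpq pq(1) pqU in auto)
    moreover have "(s, x) \<in> {(i, j). i \<in> U \<and> j \<in> U \<and> i \<noteq> j \<and> (\<exists>S. i \<in> S \<and> j \<notin> S \<and>
      (\<forall>k\<in>U \<inter> S. \<forall>l\<in>U - S. link M v k l \<le> link M v i j))}"
      by (rule cut[of _ "{p, q, r}"]) (use sx U_eq in auto)
    moreover have "(t, y) \<in> {(i, j). i \<in> U \<and> j \<in> U \<and> i \<noteq> j \<and> (\<exists>S. i \<in> S \<and> j \<notin> S \<and>
      (\<forall>k\<in>U \<inter> S. \<forall>l\<in>U - S. link M v k l \<le> link M v i j))}"
      by (rule cut[of _ "{p, q, r, x}"]) (use t U_eq dist in auto)
    ultimately show "{v} \<times> U \<union> ?T \<subseteq> {v} \<times> U \<union> {(i, j). i \<in> U \<and> j \<in> U \<and> i \<noteq> j \<and>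
      (\<exists>S. i \<in> S \<and> j \<notin> S \<and> (\<forall>k\<in>U \<inter> S. \<forall>l\<in>U - S. link M v k l \<le> link M v i j))}"
      by blast
  qed (simp add: U_def)
  then have cov: "covers V M ({v} \<times> {p, q, r, x, y} \<union> ?T)"
    using V_eq U_eq by simp
  have mono: "B \<union> S \<subseteq> (B \<union> T) \<union> (B \<union> T)\<inverse>" if "S \<subseteq> T \<union> T\<inverse>"
    for B S T :: "('a \<times> 'a) set"
    using that by blast
  have branch: ?thesis
    if "V = {v, c, x', y', z', t'}" "distinct [v, c, x', y', z', t']"
      "{(c, y'), (c, z'), (c, t')} \<subseteq> ?T \<union> ?T\<inverse>" for c x' y' z' t'
  proof -
    have "{c, x', y', z', t'} = V - {v}" using that(1,2) by auto
    then have "{c, x', y', z', t'} = {p, q, r, x, y}" using U_eq U_def by simp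
    then have "covers V M ({v} \<times> {c, x', y', z', t'} \<union> {(c, y'), (c, z'), (c, t')})"
      using covers_flip[OF cov mono[OF that(3)] sym] by simp
    then show ?thesis
      using covered_by_branch[OF sym that(2)] that(1) by simp
  qed
  have path: ?thesis
    if "V = {v, a, b, c, d, e}" "distinct [v, a, b, c, d, e]"
      "{(a, b), (b, c), (c, d), (d, e)} \<subseteq> ?T \<union> ?T\<inverse>"
      and le: "w a c \<le> w a b" "w a c \<le> w b c" "w b d \<le> w b c" "w b d \<le> w c d"
      "w c e \<le> w c d" "w c e \<le> w d e" "w a d \<le> w a b" "w a d \<le> w c d"
      "w b e \<le> w b c" "w b e \<le> w d e" "w a e \<le> w a b" "w a e \<le> w d e" for a b c d e
  proof -
    have "{a, b, c, d, e} = V - {v}" using that(1,2) by auto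
    then have "{a, b, c, d, e} = {p, q, r, x, y}" using U_eq U_def by simp
    then have "covers V M ({v} \<times> {a, b, c, d, e} \<union> {(a, b), (b, c), (c, d), (d, e)})"
      using covers_flip[OF cov mono[OF that(3)] sym] by simp
    then have "covered_by 3 V M \<or> path_type M v a b c d e"
      using covered_by_or_path_type[OF sym that(2) _ le[unfolded w_def]] that(1) by simp
    then show ?thesis using that(1,2) by blast
  qed
  \<comment> \<open>One group of inequalities per cut; together they supply the comparisons required
    by \<open>path\<close>.\<close>
  have le: "w p r \<le> w p q" "w p x \<le> w p q" "w p y \<le> w p q" "w q r \<le> w p q" "w q x \<le> w p q"
    "w q y \<le> w p q" "w r x \<le> w p q" "w r y \<le> w p q" "w x y \<le> w p q"
    using pq0(4) pq(3) U_eq dist by auto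
  have le2: "w p r \<le> w q r" "w p x \<le> w q r" "w p y \<le> w q r" "w q x \<le> w q r" "w q y \<le> w q r"
    using qr(4) pq(1) U_eq dist by auto
  have le3: "w p x \<le> w s x" "w q x \<le> w s x" "w r x \<le> w s x" "w p y \<le> w s x" "w q y \<le> w s x" "w r y \<le> w s x"
    using sx(4) U_eq dist by auto
  have le4: "w p y \<le> w t y" "w q y \<le> w t y" "w r y \<le> w t y" "w x y \<le> w t y"
    using t by auto
  note les = le le2 le3 le4
  have flip: "w q p = w p q" "w r p = w p r" "w x p = w p x" "w y p = w p y" "w r q = w q r"
    "w x q = w q x" "w y q = w q y" "w x r = w r x" "w y r = w r y" "w y x = w x y"
    by (rule ws)+
  \<comment> \<open>The tree is the path p q r with x hung on s and y hung on t. It has a vertex of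
    degree at least 3 exactly when s = q, t = q or s = t.\<close>
  from sx(1) t(1) consider "s = p" "t = p" | "s = p" "t = q" | "s = p" "t = r" | "s = p" "t = x"
    | "s = q" | "s = r" "t = p" | "s = r" "t = q" | "s = r" "t = r" | "s = r" "t = x" by blast
  then show ?thesis
  proof cases
    case 1
    show ?thesis by (rule branch[of p r q x y]) (use 1 V_eq dist in auto)
  next
    case 2
    show ?thesis by (rule branch[of q x p r y]) (use 2 V_eq dist in auto)
  next
    case 3
    show ?thesis by (rule path[of x p q r y]; (unfold flip)?) (use 3 V_eq dist les in auto)
  next
    case 4
    show ?thesis by (rule path[of y x p q r]; (unfold flip)?) (use 4 V_eq dist les in auto)
  next
    case 5
    show ?thesis by (rule branch[of q y p r x]) (use 5 V_eq dist in auto)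
  next
    case 6
    show ?thesis by (rule path[of y p q r x]; (unfold flip)?) (use 6 V_eq dist les in auto)
  next
    case 7
    show ?thesis by (rule branch[of q x p r y]) (use 7 V_eq dist in auto)
  next
    case 8
    show ?thesis by (rule branch[of r p q x y]) (use 8 V_eq dist in auto)
  next
    case 9
    show ?thesis by (rule path[of p q r x y]; (unfold flip)?) (use 9 V_eq dist les in auto)
  qed
qed

section \<open>Triangulations of the hexagon\<close>

lemma covers_glue_weak_min:
  assumes sym: "\<And>i j. M i j = M j i" and cov: "covers V M E" and E: "E \<subseteq> V \<times> V"
    and ab: "(a, b) \<in> E \<or> (b, a) \<in> E" "a \<noteq> b" and x: "x \<notin> V"
    and le: "\<And>c. c \<in> V - {a, b} \<Longrightarrow> weak_min M a b x c"
  shows "covers (insert x V) M ({(x, a), (x, b)} \<union> E)"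
proof (rule covers_glue[OF sym cov E _ _ ab(2) _ x])
  show "M x c + M a b \<le> M x a + M b c \<and> M x c + M a b \<le> M x b + M a c" if "c \<in> V - {a, b}" for c
    using le[OF that] sym[of a x] sym[of b x] by (simp add: weak_min_def add.commute)
qed (use ab E in auto)

text \<open>If a pair of long diagonals is not the strict minimum of its quadruple, the triangulation by
  \<open>b d f\<close> is completed by that quadruple and a star; otherwise the zigzag triangulation
  \<open>a e\<close>, \<open>b e\<close>, \<open>b d\<close> is completed by two quadruples.\<close>

lemma covered_by_hexagon:
  assumes sym: "\<And>i j. M i j = M j i" and dist: "distinct [a, b, c, d, e, f]"
    and w: "weak_min M b d c f" "weak_min M b f a c" "weak_min M b f a d"
      "weak_min M d f e a" "weak_min M d f e b" "weak_min M d f e c"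
      "weak_min M b d c a" "weak_min M b d c e" "weak_min M a e f b"
      "weak_min M a e f d"
  shows "covered_by 3 {a, b, c, d, e, f} M"
proof -
  let ?V = "{a, b, c, d, e, f}"
  let ?T = "{(e, d), (e, f)} \<union> ({(a, b), (a, f)} \<union> ({(c, b), (c, d)} \<union> {(b, d), (b, f), (d, f)}))"
  have star: "covers ?V M ({x} \<times> (?V - {x}))" if "x \<in> ?V" for x
    using that by (intro covers_star[OF sym]) auto
  \<comment> \<open>The remaining corners c, a, e are glued as ears onto the sides bd, bf, df of the
    inner triangle.\<close>
  have "covers {b, d, f} M {(b, d), (b, f), (d, f)}"
    by (rule covers_triangle[OF sym]) auto
  then have "covers {c, b, d, f} M ({(c, b), (c, d)} \<union> {(b, d), (b, f), (d, f)})"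
    by (rule covers_glue_weak_min[OF sym]) (use dist w in auto)
  then have "covers {a, c, b, d, f} M
      ({(a, b), (a, f)} \<union> ({(c, b), (c, d)} \<union> {(b, d), (b, f), (d, f)}))"
    by (rule covers_glue_weak_min[OF sym]) (use dist w in auto)
  then have "covers {e, a, c, b, d, f} M ?T"
    by (rule covers_glue_weak_min[OF sym]) (use dist w in auto)
  moreover have "{e, a, c, b, d, f} = ?V" by auto
  ultimately have triangle: "covers ?V M ?T" by simp
  show ?thesis
  \<comment> \<open>The triangulation misses the three long diagonals and the triangle a c e. A
    suitable quadruple takes two long diagonals and one side of a c e; the star at the third corner
    takes the rest.\<close>
  proof (cases "strict_min M d a c f \<and> strict_min M d a e b \<and> strict_min M b e c f")
    case False
    then consider "\<not> strict_min M d a c f" | "\<not> strict_min M d a e b" | "\<not> strict_min M b e c f"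
      by blast
    then show ?thesis
    proof cases
      case 1
      then have quad: "covers ?V M {(d, a), (c, f), (a, c), (a, f)}"
        by (intro covers_quad[OF sym]) (use dist in auto)
      show ?thesis
      proof (rule covered_by_sixI[OF triangle star quad])
        show "e \<in> ?V" by simp
      qed (rule subsetI, elim insertE emptyE; use dist in auto)
    next
      case 2
      then have quad: "covers ?V M {(d, a), (e, b), (a, e), (a, b)}"
        by (intro covers_quad[OF sym]) (use dist in auto)
      show ?thesis
      proof (rule covered_by_sixI[OF triangle star quad])
        show "c \<in> ?V" by simp
      qed (rule subsetI, elim insertE emptyE; use dist in auto)
    next
      case 3
      then have quad: "covers ?V M {(b, e), (c, f), (e, c), (e, f)}"
        by (intro covers_quad[OF sym]) (use dist in auto)
      show ?thesis
      proof (rule covered_by_sixI[OF triangle star quad])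
        show "a \<in> ?V" by simp
      qed (rule subsetI, elim insertE emptyE; use dist in auto)
    qed
  next
    case True
    let ?Z = "{(c, b), (c, d)} \<union> ({(f, a), (f, e)} \<union> ({(d, b), (d, e)} \<union> ({(a, b), (a, e)} \<union> {(b, e)})))"
    \<comment> \<open>Needed to glue d onto be, where a is already present: it comes from the strict
      minimum of the long diagonals ad and be.\<close>
    have bed: "weak_min M b e d a"
      using True by (simp add: weak_min_def strict_min_def sym add.commute)
    have "covers {b, e} M {(b, e)}"
      unfolding covers_def tree_on_def by (intro exI[of _ M]) (auto simp: sym)
    then have "covers {a, b, e} M ({(a, b), (a, e)} \<union> {(b, e)})"
      by (rule covers_glue_weak_min[OF sym]) (use dist in auto)
    then have "covers {d, a, b, e} M ({(d, b), (d, e)} \<union> ({(a, b), (a, e)} \<union> {(b, e)}))"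
      by (rule covers_glue_weak_min[OF sym]) (use dist bed in auto)
    then have "covers {f, d, a, b, e} M ({(f, a), (f, e)} \<union> ({(d, b), (d, e)} \<union> ({(a, b), (a, e)} \<union> {(b, e)})))"
      by (rule covers_glue_weak_min[OF sym]) (use dist w in auto)
    then have "covers {c, f, d, a, b, e} M ?Z"
      by (rule covers_glue_weak_min[OF sym]) (use dist w in auto)
    moreover have "{c, f, d, a, b, e} = ?V" by auto
    ultimately have zigzag: "covers ?V M ?Z" by simp
    \<comment> \<open>The zigzag misses bf, ce, cf and ac, df, ad. The two strict minima involving
      cf show that bf, ce and ac, df are not strict minima of their quadruples.\<close>
    have quads: "covers ?V M {(b, f), (c, e), (f, c), (f, e)}"
      "covers ?V M {(c, a), (d, f), (a, d), (a, f)}"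
      using True dist by (auto intro!: covers_quad[OF sym] simp: strict_min_def sym add.commute)
    show ?thesis
      by (rule covered_by_sixI[OF zigzag quads], rule subsetI, elim insertE emptyE; simp)
  qed
qed

section \<open>Compatibility of the paths at different vertices\<close>

lemma path_type_rev:
  assumes sym: "\<And>i j. M i j = M j i" and "path_type M v a b c d e"
  shows "path_type M v e d c b a"
  using assms(2) unfolding path_type_def weak_min_def strict_min_def by (simp add: sym add.commute)

text \<open>Up to reversal, the five possible paths arise from the cycle \<open>b c d e f\<close> by deleting an edge.\<close>

lemma path_type_end:
  assumes sym: "\<And>i j. M i j = M j i" and dist: "distinct [a, b, c, d, e, f]"
    and f: "path_type M f a b c d e"
    and dq: "distinct [q1, q2, q3, q4, q5]" and q: "{q1, q2, q3, q4, q5} = {b, c, d, e, f}"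
    and a: "path_type M a q1 q2 q3 q4 q5"
  shows "path_type M a b c d e f \<or> path_type M a b f e d c \<or> path_type M a c b f e d \<or>
    path_type M a d c b f e \<or> path_type M a e d c b f"
proof (rule ccontr)
  assume "\<not> ?thesis"
  \<comment> \<open>With reversals, these are all ten ways to traverse the cycle b c d e f with one
    edge deleted.\<close>
  then have no: "\<not> path_type M a b c d e f" "\<not> path_type M a b f e d c"
    "\<not> path_type M a c b f e d" "\<not> path_type M a d c b f e" "\<not> path_type M a e d c b f"
    "\<not> path_type M a f e d c b" "\<not> path_type M a c d e f b"
    "\<not> path_type M a d e f b c" "\<not> path_type M a e f b c d" "\<not> path_type M a f b c d e"
    using path_type_rev[where M = M and v = a, OF sym, of f e d c b] path_type_rev[where M = M and v = a, OF sym, of c d e f b]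
      path_type_rev[where M = M and v = a, OF sym, of d e f b c] path_type_rev[where M = M and v = a, OF sym, of e f b c d]
      path_type_rev[where M = M and v = a, OF sym, of f b c d e] by blast+
  have m: "q1 \<in> {b, c, d, e, f}" "q2 \<in> {b, c, d, e, f}" "q3 \<in> {b, c, d, e, f}"
    "q4 \<in> {b, c, d, e, f}" "q5 \<in> {b, c, d, e, f}"
    using q by blast+
  note F = f[unfolded path_type_def weak_min_def strict_min_def]
  \<comment> \<open>All 120 orders are enumerated: repeated vertices are discarded, the ten cyclic
    orders are excluded by \<open>no\<close>, and for every other order the inequalities at a and f
    are linearly inconsistent.\<close>
  show False
    by (insert m(1) dq, elim insertE emptyE;
      insert m(2); elim insertE emptyE; (simp only: distinct.simps list.set insert_iff simp_thms; fail)?;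
      insert m(3); elim insertE emptyE; (simp only: distinct.simps list.set insert_iff simp_thms; fail)?;
      insert m(4); elim insertE emptyE; (simp only: distinct.simps list.set insert_iff simp_thms; fail)?;
      insert m(5); elim insertE emptyE; (simp only: distinct.simps list.set insert_iff simp_thms; fail)?;
      (insert a no, simp only: simp_thms; fail)?;
      insert a F; simp only: path_type_def weak_min_def strict_min_def sym; linarith)
qed

text \<open>The options at e mirror those at a under the reversal of the path at f. Of the 25
  combinations, all but the one where both paths follow the hexagon a b c d e f contradict the
  inequalities at f.\<close>

lemma path_type_both_ends:
  assumes sym: "\<And>i j. M i j = M j i" and dist: "distinct [a, b, c, d, e, f]"
    and f: "path_type M f a b c d e"
    and a: "path_type M a b c d e f \<or> path_type M a b f e d c \<or> path_type M a c b f e d \<or>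
      path_type M a d c b f e \<or> path_type M a e d c b f"
    and e: "path_type M e d c b a f \<or> path_type M e d f a b c \<or> path_type M e c d f a b \<or>
      path_type M e b c d f a \<or> path_type M e a b c d f"
  shows "path_type M a b c d e f \<and> path_type M e d c b a f"
proof (rule ccontr)
  assume no: "\<not> ?thesis"
  show False
    by (insert a, elim disjE; insert e; elim disjE; (insert no, simp only: simp_thms; fail)?;
      insert f; simp only: path_type_def weak_min_def strict_min_def sym; linarith)
qed

lemma covered_by_three_of_card_six:
  assumes sym: "\<And>i j. M i j = M j i" and V: "finite V" "card V = 6"
  shows "covered_by 3 V M"
proof (rule ccontr)
  assume no: "\<not> covered_by 3 V M"
  have path: "\<exists>a b c d e. distinct [v, a, b, c, d, e] \<and> V = {v, a, b, c, d, e} \<and>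
      path_type M v a b c d e" if "v \<in> V" for v
    using covered_or_path_type_at[where M = M, OF sym V that] no by blast
  \<comment> \<open>An arbitrary f fixes the labelling; the paths at the two ends a and e of its
    path are then compared with it.\<close>
  obtain f where "f \<in> V" using V by fastforce
  from path[OF this] obtain a b c d e where f: "distinct [f, a, b, c, d, e]"
    "V = {f, a, b, c, d, e}" "path_type M f a b c d e"
    by blast
  have dist: "distinct [a, b, c, d, e, f]" "distinct [e, d, c, b, a, f]" using f(1) by auto
  have V_eq: "V = {a, b, c, d, e, f}" using f(2) by blast
  have "a \<in> V" "e \<in> V" using V_eq by simp_all
  from path[OF this(1)] obtain p1 p2 p3 p4 p5 where p: "distinct [a, p1, p2, p3, p4, p5]"
    "V = {a, p1, p2, p3, p4, p5}" "path_type M a p1 p2 p3 p4 p5"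
    by blast
  from path[OF \<open>e \<in> V\<close>] obtain q1 q2 q3 q4 q5 where q: "distinct [e, q1, q2, q3, q4, q5]"
    "V = {e, q1, q2, q3, q4, q5}" "path_type M e q1 q2 q3 q4 q5"
    by blast
  have "V - {a} = {p1, p2, p3, p4, p5}" using p(1,2) by auto
  moreover have "V - {a} = {b, c, d, e, f}" using V_eq dist by auto
  ultimately have "{p1, p2, p3, p4, p5} = {b, c, d, e, f}" by simp
  moreover have "distinct [p1, p2, p3, p4, p5]" using p(1) by simp
  ultimately have at_a: "path_type M a b c d e f \<or> path_type M a b f e d c \<or> path_type M a c b f e d \<or>
      path_type M a d c b f e \<or> path_type M a e d c b f"
    using path_type_end[where M = M, OF sym dist(1) f(3) _ _ p(3)] by simp
  have "V - {e} = {q1, q2, q3, q4, q5}" using q(1,2) by auto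
  moreover have "V - {e} = {d, c, b, a, f}" using V_eq dist by auto
  ultimately have "{q1, q2, q3, q4, q5} = {d, c, b, a, f}" by simp
  moreover have "distinct [q1, q2, q3, q4, q5]" using q(1) by simp
  \<comment> \<open>Reversing the path at f puts e in the place of a.\<close>
  ultimately have at_e: "path_type M e d c b a f \<or> path_type M e d f a b c \<or> path_type M e c d f a b \<or>
      path_type M e b c d f a \<or> path_type M e a b c d f"
    using path_type_end[where M = M, OF sym dist(2) path_type_rev[where M = M, OF sym f(3)] _ _ q(3)] by simp
  have "path_type M a b c d e f" "path_type M e d c b a f"
    using path_type_both_ends[where M = M, OF sym dist(1) f(3) at_a at_e] by simp_all
  \<comment> \<open>The paths at f, a and e are now the hexagon with that vertex deleted; their
    inequalities contain the ten conditions for the triangulations.\<close>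
  note facts = f(3) this
  have "weak_min M b d c f" "weak_min M b f a c" "weak_min M b f a d"
      "weak_min M d f e a" "weak_min M d f e b" "weak_min M d f e c"
      "weak_min M b d c a" "weak_min M b d c e" "weak_min M a e f b" "weak_min M a e f d"
    using facts unfolding path_type_def weak_min_def strict_min_def
    by (simp_all add: sym add.commute)
  then have "covered_by 3 V M"
    unfolding V_eq by (rule covered_by_hexagon[OF sym dist(1)])
  with no show False by blast
qed

section \<open>Induction on the number of vertices\<close>

lemma covered_by_insert:
  assumes sym: "\<And>i j. M i j = M j i" and V: "finite V" "V \<noteq> {}" "x \<notin> V"
    and cov: "covered_by k V M"
  shows "covered_by (Suc k) (insert x V) M"
proof -
  from cov obtain E where E: "\<And>s. s < k \<Longrightarrow> covers V M (E s)"
    "\<And>i j. i \<in> V \<Longrightarrow> j \<in> V \<Longrightarrow> i \<noteq> j \<Longrightarrow> \<exists>s<k. (i, j) \<in> E s \<or> (j, i) \<in> E s"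
    unfolding covered_by_def by blast
  \<comment> \<open>The old covers are restricted to \<open>V \<times> V\<close>, as extension
    requires; the additional index k carries the star at x.\<close>
  define F where "F s = (if s < k then E s \<inter> V \<times> V else {x} \<times> V)" for s
  have "covers (insert x V) M (F s)" if "s < Suc k" for s
  proof (cases "s < k")
    case True
    then have "covers V M (E s \<inter> V \<times> V)" using E(1) covers_mono by blast
    then show ?thesis
      using True covers_extend1[where M = M, OF sym _ _ V] by (simp add: F_def)
  next
    case False
    then show ?thesis
      using covers_star[where M = M, OF sym, of "insert x V" x V] V by (simp add: F_def)
  qed
  moreover have "\<exists>s<Suc k. (i, j) \<in> F s \<or> (j, i) \<in> F s"
    if "i \<in> insert x V" "j \<in> insert x V" "i \<noteq> j" for i j
  proof (cases "i \<in> V \<and> j \<in> V")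
    case True
    then show ?thesis using E(2)[of i j] that(3) by (auto simp: F_def intro: less_SucI)
  next
    case False
    then show ?thesis using that by (intro exI[of _ k]) (auto simp: F_def)
  qed
  ultimately show ?thesis unfolding covered_by_def by blast
qed

lemma covered_by_card_minus_three:
  fixes M :: "nat \<Rightarrow> nat \<Rightarrow> real"
  assumes sym: "\<And>i j. M i j = M j i" and "n \<ge> 6"
  shows "covered_by (n - 3) {1..n} M"
  using \<open>n \<ge> 6\<close>
proof (induction rule: dec_induct)
  case base
  then show ?case using covered_by_three_of_card_six[where M = M, OF sym, of "{1..6}"] by simp
next
  case (step n)
  then have "covered_by (Suc (n - 3)) (insert (Suc n) {1..n}) M"
    by (intro covered_by_insert[OF sym]) auto
  moreover have "insert (Suc n) {1..n} = {1..Suc n}" by auto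
  moreover have "Suc (n - 3) = Suc n - 3" using step by simp
  ultimately show ?case by simp
qed

section \<open>Back to dissimilarity matrices\<close>

lemma min_attained_twiceI: "min_twice a b c \<Longrightarrow> min_attained_twice [a, b, c]"
  by (auto simp: min_attained_twice_def min_twice_def min_def split: if_splits)

lemma min_of_tree_matrices_if_covered_by:
  assumes M: "M \<in> dissimilarity_matrices n" and k: "0 < k"
    and cov: "covered_by k {1..n} (\<lambda>i j. M {i, j})"
  shows "min_of_tree_matrices n M k"
proof -
  let ?V = "{1..n}"
  from cov obtain E where E: "\<forall>s<k. covers ?V (\<lambda>i j. M {i, j}) (E s)"
    "\<And>i j. i \<in> ?V \<Longrightarrow> j \<in> ?V \<Longrightarrow> i \<noteq> j \<Longrightarrow> \<exists>s<k. (i, j) \<in> E s \<or> (j, i) \<in> E s"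
    unfolding covered_by_def by blast
  from E(1) obtain D where D: "\<And>s. s < k \<Longrightarrow> tree_on ?V (D s)"
    "\<And>s i j. s < k \<Longrightarrow> i \<in> ?V \<Longrightarrow> j \<in> ?V \<Longrightarrow> i \<noteq> j \<Longrightarrow> M {i, j} \<le> D s i j"
    "\<And>s i j. s < k \<Longrightarrow> (i, j) \<in> E s \<Longrightarrow> D s i j = M {i, j}"
  proof -
    have "\<forall>s\<in>{..<k}. \<exists>D. tree_on ?V D \<and>
        (\<forall>i\<in>?V. \<forall>j\<in>?V. i \<noteq> j \<longrightarrow> M {i, j} \<le> D i j) \<and> (\<forall>(i, j)\<in>E s. D i j = M {i, j})"
      using E(1) unfolding covers_def by simp
    from bchoice[OF this] obtain D where "\<forall>s\<in>{..<k}. tree_on ?V (D s) \<and>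
        (\<forall>i\<in>?V. \<forall>j\<in>?V. i \<noteq> j \<longrightarrow> M {i, j} \<le> D s i j) \<and> (\<forall>(i, j)\<in>E s. D s i j = M {i, j})"
      by blast
    then show ?thesis by (intro that[of D]) (blast, blast, auto)
  qed
  have sym: "D s i j = D s j i" if "s < k" for s i j
    using D(1)[OF that] unfolding tree_on_def by blast
  \<comment> \<open>\<open>Min\<close> and \<open>Max\<close> choose an order of the two elements;
    symmetry of \<open>D s\<close> makes the choice irrelevant.\<close>
  define T where "T s = (\<lambda>e\<in>nsets ?V 2. D s (Min e) (Max e))" for s
  have T: "T s {i, j} = D s i j" if "s < k" "i \<in> ?V" "j \<in> ?V" "i \<noteq> j" for s i j
    using that sym[of s i j] by (auto simp: T_def nsets_def min_def max_def)
  have "tree_matrix n (T s)" if s: "s < k" for s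
    unfolding tree_matrix_def
  proof (intro conjI ballI impI)
    show "T s \<in> dissimilarity_matrices n"
      by (simp add: T_def dissimilarity_matrices_def)
    show "min_attained_twice [T s {i, j} + T s {k', l}, T s {i, k'} + T s {j, l}, T s {i, l} + T s {j, k'}]"
      if "i \<in> ?V" "j \<in> ?V" "k' \<in> ?V" "l \<in> ?V" "distinct [i, j, k', l]" for i j k' l
      using tree_onD[OF D(1)[OF s] that] that by (intro min_attained_twiceI) (simp add: T[OF s])
  qed
  moreover have "M e = (\<lambda>e\<in>nsets ?V 2. Min ((\<lambda>s. T s e) ` {..<k})) e" for e
  proof (cases "e \<in> nsets ?V 2")
    case True
    then obtain i j where e: "e = {i, j}" "i \<in> ?V" "j \<in> ?V" "i \<noteq> j"
      by (auto simp: nsets_def card_2_iff)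
    obtain s where s: "s < k" "(i, j) \<in> E s \<or> (j, i) \<in> E s" using E(2) e by blast
    have "D s i j = M e"
      using s D(3)[of s i j] D(3)[of s j i] sym[of s i j] by (auto simp: e(1) insert_commute)
    then have "T s e = M e" using T[OF s(1)] e by simp
    then have "M e \<in> (\<lambda>s. T s e) ` {..<k}" using s(1) by (metis image_eqI lessThan_iff)
    moreover have "M e \<le> T r e" if "r < k" for r
      using D(2)[OF that e(2-4)] T[OF that e(2-4)] e(1) by simp
    ultimately have "Min ((\<lambda>s. T s e) ` {..<k}) = M e" by (intro Min_eqI) auto
    then show ?thesis using True by simp
  next
    \<comment> \<open>Off the 2-subsets both sides are \<open>undefined\<close>, by extensionality
      of \<open>M\<close>.\<close>
    case False
    then show ?thesis using M by (auto simp: dissimilarity_matrices_def PiE_def extensional_def)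
  qed
  ultimately show ?thesis unfolding min_of_tree_matrices_def using k by blast
qed

theorem theorem5p5:
  fixes n :: nat and M :: "nat set \<Rightarrow> real"
  assumes "n \<ge> 6"
    and "M \<in> dissimilarity_matrices n"
  shows "tree_rank n M \<le> enat (n - 3)"
proof -
  have "covered_by (n - 3) {1..n} (\<lambda>i j. M {i, j})"
    by (rule covered_by_card_minus_three) (use assms(1) in \<open>auto simp: insert_commute\<close>)
  then have "min_of_tree_matrices n M (n - 3)"
    using assms by (intro min_of_tree_matrices_if_covered_by) auto
  then show ?thesis unfolding tree_rank_def by (intro INF_lower) simp
qed

end
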